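(* Let $k\ge 0$ and $n\ge 0$ be integers and write $N=(2k+1)n+r$ with $0\le r\le 2k$. Then for $c$ an indeterminate, \[ \det_{0\leq i,j \leq N-1}\big(\mathrm{Cat}_{i+j,k}^{(1,c)}\big) = \begin{cases} 1, & \text{if } r=0,\\ (-1)^{\binom{k+1}{2}}, & \text{if } r=k+1,\\ 0, & \text{otherwise}. \end{cases} \]
   Context: For a sequence $(s_k)_{k\ge 0}$, let $\mathrm{Cat}_{n,k}^{(s)}$ be the array defined for $n\ge 1$, $k\ge 0$ by $\mathrm{Cat}_{n,k}^{(s)}=\mathrm{Cat}_{n-1,k-1}^{(s)}+s_k \mathrm{Cat}_{n-1,k}^{(s)}+\mathrm{Cat}_{n-1,k+1}^{(s)}$, with boundary values $\mathrm{Cat}_{0,0}^{(s)}=1$, $\mathrm{Cat}_{0,k}^{(s)}=0$ for $k\ge 1$, and $\mathrm{Cat}_{n,k}^{(s)}=0$ for $k<0$. For $b\in\{0,1\}$ write $\mathrm{Cat}_{n,k}^{(b,c)}$ for $\mathrm{Cat}_{n,k}^{(s)}$ with $s=(b+c,c,c,c,\ldots)$, i.e. $s_0=b+c$ and $s_k=c$ for $k\ge 1$. The notation $\det_{0\le i,j\le N-1}(a_{i,j})$ is the determinant of the $N\times N$ matrix $(a_{i,j})$; the empty determinant ($N=0$) is $1$. *)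

theory Defs
  imports
    "HOL-Computational_Algebra.Polynomial"
    "Jordan_Normal_Form.Determinant"
begin

text \<open>The second index is an integer so that the convention that entries with negative
  second index vanish can be stated directly; the weights are only ever used at
  nonnegative positions.\<close>

primrec Cat :: "(nat \<Rightarrow> 'a::comm_ring_1) \<Rightarrow> nat \<Rightarrow> int \<Rightarrow> 'a" where
  "Cat s 0 k = (if k = 0 then 1 else 0)"
| "Cat s (Suc n) k =
     (if k < 0 then 0
      else Cat s n (k - 1) + s (nat k) * Cat s n k + Cat s n (k + 1))"

definition Cat_bc :: "'a::comm_ring_1 \<Rightarrow> 'a \<Rightarrow> nat \<Rightarrow> int \<Rightarrow> 'a" where
  "Cat_bc b c = Cat (\<lambda>k. if k = 0 then b + c else c)"

end

theory Submission
  imports Defs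
begin

text \<open>
  Let \<open>p\<^sub>0, p\<^sub>1, \<dots>\<close> be the monic polynomials with \<open>x p\<^sub>a = p\<^sub>a\<^sub>+\<^sub>1 + s\<^sub>a p\<^sub>a + p\<^sub>a\<^sub>-\<^sub>1\<close>
  for \<open>s = (1 + c, c, c, \<dots>)\<close>.  They are orthonormal for a linear functional \<open>L\<close>, the array entry
  \<open>Cat\<^sub>n\<^sub>,\<^sub>a\<close> is the coefficient of \<open>p\<^sub>a\<close> in \<open>x\<^sup>n\<close>, and so the Hankel entry \<open>Cat\<^sub>i\<^sub>+\<^sub>j\<^sub>,\<^sub>k\<close> is
  \<open>L(x\<^sup>i x\<^sup>j p\<^sub>k)\<close>.  Passing from monomials to the basis \<open>p\<^sub>a\<close> is unitriangular, so the Hankel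
  determinant equals the determinant of the matrix \<open>L(p\<^sub>a p\<^sub>b p\<^sub>k)\<close>.  The \<open>p\<^sub>a\<close> are Chebyshev polynomials
  of the third kind in the variable \<open>(x - c) / 2\<close>, whose linearisation coefficients are
  \<open>L(p\<^sub>a p\<^sub>b p\<^sub>k) = (-1)\<^bsup>a+b+k\<^esup>\<close> if \<open>a, b, k\<close> satisfy the triangle inequalities and \<open>0\<close>
  otherwise; in particular \<open>c\<close> disappears.  The proof uses the coefficients only, through the
  identity \<open>lin_coeff_commutes_with_recurrence\<close>, which says that \<open>x (p\<^sub>a p\<^sub>k) = (x p\<^sub>a) p\<^sub>k\<close>.  The
  outcome is \<open>det_Cat_bc_eq\<close>, which leaves a matrix of zeros and ones.

  Differences of consecutive rows of that matrix are sparse.  With \<open>e\<^sub>j\<close> the unit row vectors, cut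
  off at length \<open>N\<close>, they are \<open>e\<^sub>k\<close>, then \<open>e\<^sub>k\<^sub>-\<^sub>i + e\<^sub>k\<^sub>+\<^sub>i\<close> for \<open>1 \<le> i \<le> k\<close>, and
  \<open>e\<^sub>i\<^sub>+\<^sub>k - e\<^sub>i\<^sub>-\<^sub>k\<^sub>-\<^sub>1\<close> for \<open>i > k\<close>.  The two positions in the last kind of row differ by the period
  \<open>M = 2 k + 1\<close>.  Adding to every column all later columns in the same class modulo \<open>M\<close> therefore
  turns these rows into single units \<open>e\<^sub>i\<^sub>+\<^sub>k\<close>, except for the last \<open>k\<close> of them, in which
  \<open>e\<^sub>i\<^sub>+\<^sub>k\<close> was cut off.  Deleting the unit rows and their columns (\<open>det_scaled_identity_block\<close>)
  leaves an \<open>M \<times> M\<close> determinant (\<open>det_diff_row_reduce\<close>).  Its first \<open>k + 1\<close> rows span the vectors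
  that are symmetric about position \<open>k\<close>, and its last \<open>k\<close> rows are the negated units on the cyclic
  arc \<open>r, r + 1, \<dots>, r + k - 1\<close> modulo \<open>M\<close>.  It is nonzero exactly when the arc contains one
  element of each pair \<open>{k - i, k + i}\<close> and avoids \<open>k\<close>, that is, when the arc is
  \<open>{0, \<dots>, k - 1}\<close> or \<open>{k + 1, \<dots>, 2 k}\<close>; these are the cases \<open>r = 0\<close> and \<open>r = k + 1\<close>
  (\<open>det_arc_mat\<close>).  For \<open>N < M\<close> the sparse rows give the value directly (\<open>det_diff_row_small\<close>).
\<close>

section \<open>Determinants given by entry functions\<close>

lemma sum_of_bool_row:
  fixes f :: "nat \<Rightarrow> 'a::comm_ring_1"
  shows "(\<Sum>l<N. of_bool (l = p) * f l) = of_bool (p < N) * f p"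
  by (simp add: of_bool_def if_distrib [of "\<lambda>x. x * _"] cong: if_cong)

lemma det_unitriangular:
  fixes f :: "nat \<Rightarrow> nat \<Rightarrow> 'a::comm_ring_1"
  assumes "\<And>i j. i < j \<Longrightarrow> j < n \<Longrightarrow> f i j = 0"
  shows "det (mat n n (\<lambda>(i, j). f i j)) = (\<Prod>i<n. f i i)"
proof -
  have "det (mat n n (\<lambda>(i, j). f i j)) = prod_list (diag_mat (mat n n (\<lambda>(i, j). f i j)))"
    by (rule det_lower_triangular[of n]) (use assms in auto)
  also have "\<dots> = (\<Prod>i<n. f i i)"
    by (simp add: prod_list_diag_prod atLeast0LessThan)
  finally show ?thesis .
qed

lemma mat_mult_entries:
  fixes f g :: "nat \<Rightarrow> nat \<Rightarrow> 'a::comm_ring_1"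
  shows "mat n n (\<lambda>(i, j). f i j) * mat n n (\<lambda>(i, j). g i j) =
    mat n n (\<lambda>(i, j). \<Sum>l<n. f i l * g l j)"
  by (rule eq_matI) (auto simp: scalar_prod_def atLeast0LessThan)

text \<open>The increasing enumeration of the naturals outside \<open>{a..<a + m}\<close>.\<close>
definition skip :: "nat \<Rightarrow> nat \<Rightarrow> nat \<Rightarrow> nat" where
  "skip a m i = (if i < a then i else i + m)"

text \<open>If \<open>m\<close> consecutive rows from row \<open>a\<close> on vanish outside a scaled identity block in the columns
  from \<open>b\<close> on, expanding along them one after the other deletes the block.  All pivots lie on one
  diagonal, so every expansion contributes the sign of position \<open>(a, b)\<close>.\<close>
lemma det_scaled_identity_block:
  fixes f :: "nat \<Rightarrow> nat \<Rightarrow> 'a::comm_ring_1"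
  assumes "a \<le> n" "b \<le> n"
    and "\<And>l j. l < m \<Longrightarrow> j < n + m \<Longrightarrow> f (a + l) j = (if j = b + l then x else 0)"
  shows "det (mat (n + m) (n + m) (\<lambda>(i, j). f i j)) =
    (x * (-1) ^ (a + b)) ^ m * det (mat n n (\<lambda>(i, j). f (skip a m i) (skip b m j)))"
  using assms
proof (induction m arbitrary: f)
  case 0
  have "skip a 0 = (\<lambda>i. i)" for a by (simp add: skip_def fun_eq_iff)
  then show ?case by simp
next
  case (Suc m)
  let ?A = "mat (Suc (n + m)) (Suc (n + m)) (\<lambda>(i, j). f i j)"
  let ?g = "\<lambda>i j. f (skip (a + m) 1 i) (skip (b + m) 1 j)"
  have "det ?A = (\<Sum>j<Suc (n + m). ?A $$ (a + m, j) * cofactor ?A (a + m) j)"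
    by (rule laplace_expansion_row) (use Suc.prems in auto)
  also have "\<dots> = (\<Sum>j<Suc (n + m). if j = b + m then x * cofactor ?A (a + m) (b + m) else 0)"
    by (rule sum.cong) (use Suc.prems in auto)
  also have "\<dots> = x * cofactor ?A (a + m) (b + m)"
    using Suc.prems by simp
  also have "cofactor ?A (a + m) (b + m) =
      (-1) ^ (a + b) * det (mat (n + m) (n + m) (\<lambda>(i, j). ?g i j))"
  proof -
    have "mat_delete ?A (a + m) (b + m) = mat (n + m) (n + m) (\<lambda>(i, j). ?g i j)"
      by (rule eq_matI) (auto simp: mat_delete_def skip_def)
    moreover have "(-1 :: 'a) ^ (a + m + (b + m)) = (-1) ^ (a + b)"
      by (simp add: power_add mult.assoc mult.left_commute flip: power_mult_distrib)
    ultimately show ?thesis by (simp add: cofactor_def)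
  qed
  also have "det (mat (n + m) (n + m) (\<lambda>(i, j). ?g i j)) =
      (x * (-1) ^ (a + b)) ^ m *
      det (mat n n (\<lambda>(i, j). ?g (skip a m i) (skip b m j)))"
  proof (rule Suc.IH)
    fix l j assume "l < m" "j < n + m"
    then show "?g (a + l) j = (if j = b + l then x else 0)"
      using Suc.prems(3)[of l "skip (b + m) 1 j"] by (auto simp: skip_def)
  qed (use Suc.prems in auto)
  also have "mat n n (\<lambda>(i, j). ?g (skip a m i) (skip b m j)) =
      mat n n (\<lambda>(i, j). f (skip a (Suc m) i) (skip b (Suc m) j))"
    by (rule eq_matI) (auto simp: skip_def)
  finally show ?case by (simp add: mult.assoc)
qed

lemma det_antidiagonal:
  "det (mat n n (\<lambda>(i, j). if i + j + 1 = n then 1 else 0)) = ((-1) ^ (n choose 2) :: 'a::comm_ring_1)"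
proof (induction n)
  case 0
  then show ?case by (simp add: numeral_2_eq_2)
next
  case (Suc n)
  have "det (mat (n + 1) (n + 1) (\<lambda>(i, j). if i + j + 1 = Suc n then 1 else 0)) =
    (1 * (-1 :: 'a) ^ (0 + n)) ^ 1 * det (mat n n (\<lambda>(i, j).
      if skip 0 1 i + skip n 1 j + 1 = Suc n then 1 else 0))"
    by (rule det_scaled_identity_block) auto
  also have "mat n n (\<lambda>(i, j). if skip 0 1 i + skip n 1 j + 1 = Suc n then 1 else (0::'a)) =
    mat n n (\<lambda>(i, j). if i + j + 1 = n then 1 else 0)"
    by (rule eq_matI) (auto simp: skip_def)
  finally show ?case
    using Suc.IH by (simp add: numeral_2_eq_2 power_add)
qed

text \<open>The relation between the rows of \<open>A\<close> carries over to the rows of \<open>A adj(A) = det(A) 1\<close>, and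
  there its entry in column \<open>p\<close> reads \<open>det A = 0\<close>.  This works over rings with zero divisors.\<close>
lemma det_eq_0_if_row_dependent:
  fixes f :: "nat \<Rightarrow> nat \<Rightarrow> 'a::comm_ring_1"
  assumes "p < n" "S \<subseteq> {..<n} - {p}"
    and "\<And>j. j < n \<Longrightarrow> f p j = (\<Sum>i\<in>S. w i * f i j)"
  shows "det (mat n n (\<lambda>(i, j). f i j)) = 0"
proof -
  let ?A = "mat n n (\<lambda>(i, j). f i j)"
  have A: "?A \<in> carrier_mat n n" by simp
  have adj: "(\<Sum>j<n. f i j * adj_mat ?A $$ (j, p)) = (if i = p then det ?A else 0)" if "i < n" for i
  proof -
    have "(\<Sum>j<n. f i j * adj_mat ?A $$ (j, p)) = (?A * adj_mat ?A) $$ (i, p)"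
      using that \<open>p < n\<close> adj_mat(1)[OF A] by (simp add: scalar_prod_def atLeast0LessThan)
    also have "\<dots> = (if i = p then det ?A else 0)"
      unfolding adj_mat(2)[OF A] using that \<open>p < n\<close> by simp
    finally show ?thesis .
  qed
  have "det ?A = (\<Sum>j<n. (\<Sum>i\<in>S. w i * f i j) * adj_mat ?A $$ (j, p))"
    using adj[of p] assms by simp
  also have "\<dots> = (\<Sum>i\<in>S. w i * (\<Sum>j<n. f i j * adj_mat ?A $$ (j, p)))"
    by (simp add: sum_distrib_left sum_distrib_right mult.assoc, subst sum.swap) simp
  also have "\<dots> = 0"
  proof (rule sum.neutral, rule ballI)
    fix i assume "i \<in> S"
    then have "i < n" "i \<noteq> p" using assms(2) by auto
    then show "w i * (\<Sum>j<n. f i j * adj_mat ?A $$ (j, p)) = 0" by (simp add: adj)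
  qed
  finally show ?thesis .
qed

section \<open>From the Hankel matrix to linearisation coefficients\<close>

definition triangle :: "nat \<Rightarrow> nat \<Rightarrow> nat \<Rightarrow> bool" where
  "triangle k i j \<longleftrightarrow> i \<le> j + k \<and> j \<le> i + k \<and> k \<le> i + j"

lemma Cat_eq_0: "int n < k \<or> k < 0 \<Longrightarrow> Cat s n k = 0"
  by (induction n arbitrary: k) auto

lemma Cat_diag: "Cat s n (int n) = 1"
  by (induction n) (auto simp: Cat_eq_0)

text \<open>One step of the recurrence multiplies the row vector \<open>Cat\<^sub>i\<close> by a tridiagonal matrix with
  off-diagonal entries 1.  That matrix is symmetric, so it can be applied to \<open>f\<close> instead.  The bound
  \<open>i < R\<close> keeps the support of \<open>Cat\<^sub>i\<^sub>+\<^sub>1\<close> inside the range of summation.\<close>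
lemma Cat_sum_adjoint:
  fixes f :: "nat \<Rightarrow> 'a::comm_ring_1"
  assumes "i < R"
  shows "(\<Sum>a\<le>R. Cat s (Suc i) (int a) * f a) =
    (\<Sum>a\<le>R. Cat s i (int a) * ((if a = 0 then 0 else f (a - 1)) + s a * f a + f (Suc a)))"
proof -
  have up: "(\<Sum>a\<le>R. Cat s i (int a - 1) * f a) = (\<Sum>a\<le>R. Cat s i (int a) * f (Suc a))"
  proof -
    obtain R' where R: "R = Suc R'" using assms by (cases R) auto
    show ?thesis
      using assms unfolding R
      by (subst sum.atMost_Suc_shift) (simp add: Cat_eq_0)
  qed
  have down: "(\<Sum>a\<le>R. Cat s i (int a + 1) * f a) =
      (\<Sum>a\<le>R. Cat s i (int a) * (if a = 0 then 0 else f (a - 1)))"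
  proof -
    obtain R' where R: "R = Suc R'" using assms by (cases R) auto
    show ?thesis
      using assms unfolding R
      by (subst (2) sum.atMost_Suc_shift) (simp add: Cat_eq_0 add.commute)
  qed
  have "(\<Sum>a\<le>R. Cat s (Suc i) (int a) * f a) =
      (\<Sum>a\<le>R. Cat s i (int a - 1) * f a) + (\<Sum>a\<le>R. Cat s i (int a) * (s a * f a)) +
      (\<Sum>a\<le>R. Cat s i (int a + 1) * f a)"
    by (simp add: algebra_simps flip: sum.distrib)
  also have "\<dots> = (\<Sum>a\<le>R. Cat s i (int a) * ((if a = 0 then 0 else f (a - 1)) + s a * f a + f (Suc a)))"
    unfolding up down by (simp add: algebra_simps flip: sum.distrib)
  finally show ?thesis .
qed

text \<open>The coefficient of \<open>p\<^sub>b\<close> in \<open>p\<^sub>a p\<^sub>k\<close>, where the polynomials \<open>p\<^sub>a\<close> satisfy the recurrence with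
  weights \<open>(1 + c, c, c, \<dots>)\<close>.\<close>
definition lin_coeff :: "nat \<Rightarrow> nat \<Rightarrow> nat \<Rightarrow> 'a::comm_ring_1" where
  "lin_coeff k a b = (-1) ^ (a + b + k) * of_bool (triangle k a b)"

text \<open>Multiplication by \<open>p\<^sub>k\<close> commutes with multiplication by \<open>x\<close>.  The weight \<open>1 + c\<close> at
  position 0 matters: its extra 1 compensates for the missing neighbour at position \<open>-1\<close>.\<close>
lemma lin_coeff_commutes_with_recurrence:
  fixes c :: "'a::comm_ring_1"
  defines "s \<equiv> \<lambda>a::nat. if a = 0 then 1 + c else c"
  shows "(if a = 0 then 0 else lin_coeff k (a - 1) b) + s a * lin_coeff k a b + lin_coeff k (Suc a) b =
    (if b = 0 then 0 else lin_coeff k a (b - 1)) + s b * lin_coeff k a b + lin_coeff k a (Suc b)"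
  by (cases a; cases b) (auto simp: s_def lin_coeff_def triangle_def algebra_simps of_bool_def)

text \<open>The functional value \<open>L(x\<^sup>i x\<^sup>j p\<^sub>k)\<close>, expanded in the basis \<open>p\<^sub>a\<close>; the expansion is complete as
  soon as \<open>R\<close> is at least \<open>i\<close> and \<open>j\<close>.\<close>
definition cat_form :: "nat \<Rightarrow> nat \<Rightarrow> 'a::comm_ring_1 \<Rightarrow> nat \<Rightarrow> nat \<Rightarrow> 'a" where
  "cat_form R k c i j =
    (\<Sum>a\<le>R. \<Sum>b\<le>R. Cat_bc 1 c i (int a) * (Cat_bc 1 c j (int b) * lin_coeff k a b))"

lemma cat_form_shift:
  assumes "i < R" "j < R"
  shows "cat_form R k c (Suc i) j = cat_form R k c i (Suc j)"
proof -
  let ?s = "\<lambda>a::nat. if a = 0 then 1 + c else c"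
  let ?C = "\<lambda>i a. Cat ?s i (int a)"
  have "cat_form R k c (Suc i) j = (\<Sum>a\<le>R. ?C (Suc i) a * (\<Sum>b\<le>R. ?C j b * lin_coeff k a b))"
    unfolding cat_form_def Cat_bc_def by (simp only: sum_distrib_left)
  also have "\<dots> = (\<Sum>a\<le>R. ?C i a * (\<Sum>b\<le>R. ?C j b *
      ((if a = 0 then 0 else lin_coeff k (a - 1) b) + ?s a * lin_coeff k a b + lin_coeff k (Suc a) b)))"
    unfolding Cat_sum_adjoint[OF assms(1)]
    by (intro sum.cong refl arg_cong2[where f = "(*)"])
      (auto simp: algebra_simps sum.distrib sum_distrib_left simp del: Cat.simps)
  also have "\<dots> = (\<Sum>a\<le>R. ?C i a * (\<Sum>b\<le>R. ?C j b *
      ((if b = 0 then 0 else lin_coeff k a (b - 1)) + ?s b * lin_coeff k a b + lin_coeff k a (Suc b))))"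
    unfolding lin_coeff_commutes_with_recurrence ..
  also have "\<dots> = (\<Sum>a\<le>R. ?C i a * (\<Sum>b\<le>R. ?C (Suc j) b * lin_coeff k a b))"
    unfolding Cat_sum_adjoint[OF assms(2)] ..
  also have "\<dots> = cat_form R k c i (Suc j)"
    unfolding cat_form_def Cat_bc_def by (simp only: sum_distrib_left)
  finally show ?thesis .
qed

text \<open>By the preceding shift every power of \<open>x\<close> moves to the second argument, and
  \<open>p\<^sub>0 p\<^sub>k = p\<^sub>k\<close> evaluates the form when the first exponent is 0.\<close>
lemma Cat_bc_eq_cat_form:
  assumes "i + j \<le> R"
  shows "Cat_bc 1 c (i + j) (int k) = cat_form R k c i j"
  using assms
proof (induction i arbitrary: j)
  case 0
  have "cat_form R k c 0 j =
      (\<Sum>a\<le>R. if a = 0 then \<Sum>b\<le>R. Cat_bc 1 c j (int b) * lin_coeff k 0 b else 0)"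
    unfolding cat_form_def by (intro sum.cong) (auto simp: Cat_bc_def)
  also have "\<dots> = (\<Sum>b\<le>R. Cat_bc 1 c j (int b) * lin_coeff k 0 b)" by simp
  also have "\<dots> = (\<Sum>b\<le>R. if b = k then Cat_bc 1 c j (int k) else 0)"
    by (intro sum.cong) (auto simp: lin_coeff_def triangle_def simp flip: mult_2)
  also have "\<dots> = Cat_bc 1 c j (int k)"
    using 0 by (auto simp: Cat_bc_def Cat_eq_0)
  finally show ?case by simp
next
  case (Suc i)
  then show ?case
    using Suc.IH[of "Suc j"] cat_form_shift[of i R j k c] by simp
qed

lemma Cat_bc_convolution:
  assumes "i < N" "j < N"
  shows "Cat_bc 1 c (i + j) (int k) =
    (\<Sum>a<N. Cat_bc 1 c i (int a) * (\<Sum>b<N. lin_coeff k a b * Cat_bc 1 c j (int b)))"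
proof -
  have *: "(\<Sum>a\<le>i + j + N. Cat_bc 1 c l (int a) * g a) = (\<Sum>a<N. Cat_bc 1 c l (int a) * g a)"
    if "l < N" for l g
    by (rule sum.mono_neutral_right) (use that in \<open>auto simp: Cat_bc_def Cat_eq_0\<close>)
  have "Cat_bc 1 c (i + j) (int k) = (\<Sum>a\<le>i + j + N. Cat_bc 1 c i (int a) *
      (\<Sum>b\<le>i + j + N. Cat_bc 1 c j (int b) * lin_coeff k a b))"
    by (subst Cat_bc_eq_cat_form[where R = "i + j + N"]) (simp_all add: cat_form_def sum_distrib_left)
  then show ?thesis
    using assms by (simp add: * mult.commute[of "lin_coeff _ _ _"])
qed

text \<open>The sign \<open>(-1)\<^bsup>a+b\<^esup>\<close> of the linearisation coefficients is absorbed into the two factors of the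
  change of basis, whose determinants are then equal signs and cancel; \<open>(-1)\<^sup>k\<close> scales every row.\<close>
lemma det_Cat_bc_eq:
  fixes c :: "'a::comm_ring_1"
  shows "det (mat N N (\<lambda>(i, j). Cat_bc 1 c (i + j) (int k))) =
    (-1) ^ (k * N) * det (mat N N (\<lambda>(i, j). of_bool (triangle k i j)))"
proof -
  define K where "K = mat N N (\<lambda>(i, j). (-1) ^ j * Cat_bc 1 c i (int j))"
  define B :: "'a mat" where "B = mat N N (\<lambda>(i, j). of_bool (triangle k i j))"
  have [simp]: "K \<in> carrier_mat N N" "B \<in> carrier_mat N N"
    by (auto simp: K_def B_def)
  have "mat N N (\<lambda>(i, j). Cat_bc 1 c (i + j) (int k)) = (-1) ^ k \<cdot>\<^sub>m (K * (B * K\<^sup>T))"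
  proof (rule eq_matI)
    fix i j assume ij: "i < dim_row ((-1) ^ k \<cdot>\<^sub>m (K * (B * K\<^sup>T)))"
      "j < dim_col ((-1) ^ k \<cdot>\<^sub>m (K * (B * K\<^sup>T)))"
    then have "i < N" "j < N" by (auto simp: K_def)
    then show "mat N N (\<lambda>(i, j). Cat_bc 1 c (i + j) (int k)) $$ (i, j) =
        ((-1) ^ k \<cdot>\<^sub>m (K * (B * K\<^sup>T))) $$ (i, j)"
      by (auto simp: Cat_bc_convolution[of i N j] K_def B_def scalar_prod_def atLeast0LessThan
          lin_coeff_def sum_distrib_left power_add mult_ac intro!: sum.cong)
  qed (auto simp: K_def)
  then have "det (mat N N (\<lambda>(i, j). Cat_bc 1 c (i + j) (int k))) =
      (-1) ^ (k * N) * (det K * (det B * det K))"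
    using det_mult[OF \<open>K \<in> carrier_mat N N\<close> mult_carrier_mat[of B N N "K\<^sup>T" N]] det_mult[of B N "K\<^sup>T"] det_transpose[of K N]
    by (simp add: power_mult carrier_matD[of K N N])
  moreover have "det K * det K = 1"
    unfolding K_def
    by (subst (1 2) det_unitriangular)
      (auto simp: Cat_bc_def Cat_eq_0 Cat_diag simp flip: prod.distrib power_add mult_2)
  ultimately show ?thesis
    by (simp add: B_def[symmetric] mult_ac)
qed

section \<open>Differences of consecutive rows\<close>

text \<open>Row \<open>i\<close> minus row \<open>i - 1\<close> of the matrix \<open>of_bool (triangle k i j)\<close>.  Row \<open>i\<close> of that matrix is
  the indicator of the interval from \<open>\<bar>i - k\<bar>\<close> to \<open>i + k\<close>, which grows at both ends while
  \<open>i \<le> k\<close> and moves to the right afterwards.\<close>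
definition diff_row :: "nat \<Rightarrow> nat \<Rightarrow> nat \<Rightarrow> 'a::comm_ring_1" where
  "diff_row k i j =
    (if i = 0 then of_bool (j = k)
     else if i \<le> k then of_bool (j = k - i) + of_bool (j = k + i)
     else of_bool (j = i + k) - of_bool (j = i - Suc k))"

lemma sum_diff_row: "(\<Sum>l\<le>i. diff_row k l j) = of_bool (triangle k i j)"
  by (induction i) (auto simp: diff_row_def triangle_def of_bool_def)

lemma det_triangle_eq_det_diff_row:
  "det (mat N N (\<lambda>(i, j). of_bool (triangle k i j))) =
   det (mat N N (\<lambda>(i, j). diff_row k i j :: 'a::comm_ring_1))"
proof -
  let ?L = "mat N N (\<lambda>(i, j). of_bool (j \<le> i) :: 'a)"
  have "mat N N (\<lambda>(i, j). of_bool (triangle k i j)) = ?L * mat N N (\<lambda>(i, j). diff_row k i j)"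
    unfolding mat_mult_entries
  proof (rule cong_mat, simp, simp, clarify)
    fix i j assume "i < N"
    have "(\<Sum>l<N. of_bool (l \<le> i) * diff_row k l j) = (\<Sum>l\<le>i. diff_row k l j :: 'a)"
      by (rule sum.mono_neutral_cong_right) (use \<open>i < N\<close> in auto)
    then show "of_bool (triangle k i j) = (\<Sum>l<N. of_bool (l \<le> i) * diff_row k l j :: 'a)"
      by (simp add: sum_diff_row)
  qed
  moreover have "det ?L = 1"
    by (subst det_unitriangular) auto
  ultimately show ?thesis
    by (simp add: det_mult[of _ N])
qed

section \<open>Reduction modulo the period\<close>

text \<open>The rows below row \<open>k\<close> are the negated unit vectors on the cyclic arc of length \<open>k\<close> that starts
  at \<open>r\<close>.\<close>
definition arc_mat :: "nat \<Rightarrow> nat \<Rightarrow> nat \<Rightarrow> nat \<Rightarrow> 'a::comm_ring_1" where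
  "arc_mat k r i j =
    (if i \<le> k then diff_row k i j else - of_bool (j = (r + (i - Suc k)) mod (2 * k + 1)))"

text \<open>Among the positions \<open>j \<le> q + M\<close> that are congruent to \<open>q\<close>, only \<open>q + M\<close> itself exceeds
  \<open>q\<close>.  This is why summing the columns of a residue class turns a row \<open>e\<^sub>q\<^sub>+\<^sub>M - e\<^sub>q\<close> into
  a unit vector.\<close>
lemma periodic_column_difference:
  fixes j q M :: nat
  assumes "M > 0"
  shows "of_bool (j \<le> q + M \<and> (q + M) mod M = j mod M) - of_bool (j \<le> q \<and> q mod M = j mod M) =
    (of_bool (j = q + M) :: 'a::comm_ring_1)"
proof -
  have "j = q + M" if "q < j" "j \<le> q + M" "q mod M = j mod M"
  proof -
    have "M dvd j - q"
      using that by (metis less_imp_le mod_eq_dvd_iff_nat)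
    then have "M \<le> j - q" using that by (auto dest: dvd_imp_le)
    then show ?thesis using that by simp
  qed
  then show ?thesis using assms by auto
qed

lemma det_diff_row_reduce:
  assumes "N = (2 * k + 1) * n + r" "n > 0"
  shows "det (mat N N (\<lambda>(i, j). diff_row k i j)) =
    (-1) ^ (k * (N - (2 * k + 1))) *
    det (mat (2 * k + 1) (2 * k + 1) (\<lambda>(i, j). arc_mat k r i j :: 'a::comm_ring_1))"
proof -
  define M where "M = 2 * k + 1"
  define m where "m = N - M"
  have M: "M > 0" by (simp add: M_def)
  have N: "N = M + m"
    using assms unfolding m_def M_def by (cases n) auto
  have Nr: "N mod M = r mod M"
    unfolding assms(1) M_def[symmetric] by simp
  let ?P = "\<lambda>l j. of_bool (j \<le> l \<and> l mod M = j mod M) :: 'a"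
  \<comment> \<open>\<open>?P\<close> is the unitriangular matrix that adds to each column the later ones of its residue class,
      and \<open>E\<close> is the resulting matrix.\<close>
  define E where "E = (\<lambda>i j. if i \<le> k then diff_row k i j else
    if i + k < N then of_bool (j = i + k) else - ?P (i + k - M) j)"
  have "mat N N (\<lambda>(i, j). diff_row k i j) * mat N N (\<lambda>(i, j). ?P i j) = mat N N (\<lambda>(i, j). E i j)"
    unfolding mat_mult_entries
  proof (rule cong_mat, simp, simp, clarify)
    fix i j assume "i < N" "j < N"
    have small: "?P p j = of_bool (j = p)" if "p < M" for p
      using that by auto
    consider "i = 0" | "0 < i" "i \<le> k" | "k < i" by linarith
    then show "(\<Sum>l<N. diff_row k i l * ?P l j) = E i j"
    proof cases
      case 1
      have "(\<Sum>l<N. diff_row k i l * ?P l j) = of_bool (k < N) * ?P k j"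
        unfolding sum_of_bool_row[symmetric] using 1 by (simp add: diff_row_def)
      with 1 show ?thesis
        using small[of k] N by (simp add: E_def M_def diff_row_def)
    next
      case 2
      have "(\<Sum>l<N. diff_row k i l * ?P l j) =
          of_bool (k - i < N) * ?P (k - i) j + of_bool (k + i < N) * ?P (k + i) j"
        unfolding sum_of_bool_row[symmetric] using 2 by (simp add: diff_row_def distrib_right sum.distrib)
      moreover have "k - i < M" "k + i < M" "k - i < N" "k + i < N"
        using 2 N by (auto simp: M_def)
      ultimately show ?thesis
        using 2 small[of "k - i"] small[of "k + i"]
        by (simp only: E_def diff_row_def) (simp add: diff_row_def)
    next
      case 3
      define q where "q = i - Suc k"
      have q: "i + k = q + M" "i - Suc k = q" "i + k - M = q" "q < N"
        using 3 \<open>i < N\<close> by (auto simp: q_def M_def)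
      have "(\<Sum>l<N. diff_row k i l * ?P l j) =
          of_bool (q + M < N) * ?P (q + M) j - of_bool (q < N) * ?P q j"
        unfolding sum_of_bool_row[symmetric] using 3 q
        by (simp add: diff_row_def left_diff_distrib sum_subtractf)
      then show ?thesis
        using 3 q periodic_column_difference[OF M, of j q, where 'a = 'a] by (simp add: E_def)
    qed
  qed
  moreover have "det (mat N N (\<lambda>(i, j). ?P i j)) = 1"
    by (subst det_unitriangular) auto
  ultimately have "det (mat N N (\<lambda>(i, j). diff_row k i j)) = det (mat N N (\<lambda>(i, j). E i j))"
    using det_mult[OF mat_carrier mat_carrier, of N "\<lambda>(i, j). diff_row k i j" "\<lambda>(i, j). ?P i j"]
    by simp
  \<comment> \<open>Rows \<open>k + 1, \<dots>, N - k - 1\<close> of \<open>E\<close> carry an identity block in the columns \<open>M, \<dots>, N - 1\<close>.\<close>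
  also have "\<dots> = (1 * (-1) ^ (Suc k + M)) ^ m *
      det (mat M M (\<lambda>(i, j). E (skip (Suc k) m i) (skip M m j)))"
    unfolding N by (rule det_scaled_identity_block) (auto simp: E_def M_def N)
  also have "(1 * (-1) ^ (Suc k + M)) ^ m = (-1 :: 'a) ^ (k * m)"
    by (simp add: M_def power_mult power_add)
  also have "mat M M (\<lambda>(i, j). E (skip (Suc k) m i) (skip M m j)) = mat M M (\<lambda>(i, j). arc_mat k r i j)"
  proof (rule cong_mat, simp, simp, clarify)
    fix i j assume ij: "i < M" "j < M"
    show "E (skip (Suc k) m i) (skip M m j) = arc_mat k r i j"
    proof (cases "i \<le> k")
      case True
      then show ?thesis using ij by (simp add: E_def arc_mat_def skip_def)
    next
      case False
      define u where "u = i - Suc k"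
      have u: "i = Suc k + u" "i + m + k - M = m + u" "i + m + k = N + u"
        using False ij by (auto simp: u_def N M_def)
      have "(m + u) mod M = (r + u) mod M"
        using Nr by (metis N mod_add_left_eq mod_add_self1)
      moreover have "(m + u) mod M \<le> m + u" by simp
      ultimately have "?P (m + u) j = of_bool (j = (r + u) mod M)"
        using ij by auto
      moreover have "E (skip (Suc k) m i) (skip M m j) = - ?P (m + u) j"
        using False ij u by (simp add: E_def skip_def)
      moreover have "arc_mat k r i j = - (of_bool (j = (r + u) mod M) :: 'a)"
        using u(1) by (simp add: arc_mat_def M_def)
      ultimately show ?thesis by simp
    qed
  qed
  finally show ?thesis by (simp add: M_def m_def)
qed

section \<open>Evaluation of the reduced determinants\<close>

lemma det_antidiagonal_corner:
  assumes "\<And>i j. i \<le> k \<Longrightarrow> j \<le> k \<Longrightarrow> f i j = diff_row k i j"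
  shows "det (mat (Suc k) (Suc k) (\<lambda>(i, j). f i j)) = ((-1) ^ (Suc k choose 2) :: 'a::comm_ring_1)"
proof -
  have "mat (Suc k) (Suc k) (\<lambda>(i, j). f i j) =
      mat (Suc k) (Suc k) (\<lambda>(i, j). if i + j + 1 = Suc k then 1 else (0::'a))"
    by (rule cong_mat) (auto simp: assms diff_row_def)
  then show ?thesis by (simp only: det_antidiagonal)
qed

text \<open>In both nonzero cases the arc fills one half of the positions, so its units delete that half and
  leave the symmetric rows restricted to the other one: an identity for \<open>r = 0\<close>, an antidiagonal for
  \<open>r = k + 1\<close>.\<close>
lemma det_arc_mat:
  assumes "r \<le> 2 * k"
  shows "det (mat (2 * k + 1) (2 * k + 1) (\<lambda>(i, j). arc_mat k r i j)) =
    (-1) ^ k * (if r = 0 then 1 else if r = k + 1 then (-1) ^ (Suc k choose 2)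
      else (0 :: 'a::comm_ring_1))"
proof -
  let ?A = "mat (2 * k + 1) (2 * k + 1) (\<lambda>(i, j). arc_mat k r i j :: 'a)"
  have size: "2 * k + 1 = Suc k + k" by simp
  consider "r = 0" | "r = k + 1" | "0 < r" "r \<le> k" | "k + 2 \<le> r" by linarith
  then show ?thesis
  proof cases
    case 1
    have "det ?A = ((-1) * (-1) ^ (Suc k + 0)) ^ k * det (mat (Suc k) (Suc k)
        (\<lambda>(i, j). arc_mat k r (skip (Suc k) k i) (skip 0 k j)))"
      unfolding size by (rule det_scaled_identity_block) (use 1 in \<open>auto simp: arc_mat_def\<close>)
    also have "mat (Suc k) (Suc k) (\<lambda>(i, j). arc_mat k r (skip (Suc k) k i) (skip 0 k j)) =
        (1\<^sub>m (Suc k) :: 'a mat)"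
      by (rule eq_matI) (auto simp: arc_mat_def skip_def diff_row_def)
    also have "((-1) * (-1) ^ (Suc k + 0)) ^ k = (-1 :: 'a) ^ k"
      by (cases "even k") auto
    finally show ?thesis using 1 by simp
  next
    case 2
    have "det ?A = ((-1) * (-1) ^ (Suc k + Suc k)) ^ k * det (mat (Suc k) (Suc k)
        (\<lambda>(i, j). arc_mat k r (skip (Suc k) k i) (skip (Suc k) k j)))"
      unfolding size by (rule det_scaled_identity_block) (use 2 in \<open>auto simp: arc_mat_def\<close>)
    also have "\<dots> = (-1) ^ k * (-1) ^ (Suc k choose 2)"
      by (subst det_antidiagonal_corner) (auto simp: arc_mat_def skip_def)
    finally show ?thesis using 2 by simp
  next
    case 3
    \<comment> \<open>The arc contains \<open>k\<close>, and \<open>e\<^sub>k\<close> is also the first row.\<close>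
    have "det ?A = 0"
    proof (rule det_eq_0_if_row_dependent[where p = 0 and S = "{Suc k + (k - r)}" and w = "\<lambda>_. -1"])
      fix j :: nat
      have "(r + (k - r)) mod (2 * k + 1) = k" "\<not> Suc k + (k - r) \<le> k" using 3 by simp_all
      then show "arc_mat k r 0 j = (\<Sum>i\<in>{Suc k + (k - r)}. - 1 * (arc_mat k r i j :: 'a))"
        by (simp add: arc_mat_def diff_row_def del: add_diff_assoc)
    qed (use 3 in auto)
    then show ?thesis using 3 by simp
  next
    case 4
    \<comment> \<open>The arc contains \<open>2 k\<close> and wraps around to \<open>0\<close>, and row \<open>k\<close> is \<open>e\<^sub>0 + e\<^sub>2\<^sub>k\<close>.\<close>
    let ?q = "Suc k + (2 * k - r)"
    have "det ?A = 0"
    proof (rule det_eq_0_if_row_dependent[where p = k and S = "{?q, Suc ?q}" and w = "\<lambda>_. -1"])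
      fix j :: nat
      have "(r + (2 * k - r)) mod (2 * k + 1) = 2 * k" "(r + Suc (2 * k - r)) mod (2 * k + 1) = 0"
        "0 < k" "\<not> ?q \<le> k"
        using 4 assms by auto
      then show "arc_mat k r k j = (\<Sum>i\<in>{?q, Suc ?q}. - 1 * (arc_mat k r i j :: 'a))"
        using 4 by (auto simp: arc_mat_def diff_row_def Suc_diff_le)
    qed (use 4 assms in auto)
    then show ?thesis using 4 by simp
  qed
qed

text \<open>Below the period the truncation removes \<open>e\<^sub>i\<^sub>+\<^sub>k\<close> from all rows \<open>i \<ge> k\<close>, so the determinant can
  be read off: row 0 vanishes for \<open>0 < N \<le> k\<close>, and rows \<open>k\<close> and \<open>k + 1\<close> are \<open>e\<^sub>0\<close> and \<open>-e\<^sub>0\<close> for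
  \<open>N \<ge> k + 2\<close>.\<close>
lemma det_diff_row_small:
  assumes "N \<le> 2 * k"
  shows "det (mat N N (\<lambda>(i, j). diff_row k i j)) =
    (if N = 0 then 1 else if N = k + 1 then (-1) ^ (Suc k choose 2) else (0 :: 'a::comm_ring_1))"
proof -
  consider "N = 0" | "0 < N" "N \<le> k" | "N = Suc k" | "k + 2 \<le> N" by linarith
  then show ?thesis
  proof cases
    case 2
    then show ?thesis
      by (subst det_eq_0_if_row_dependent[where p = 0 and S = "{}"]) (auto simp: diff_row_def)
  next
    case 3
    then show ?thesis by (simp add: det_antidiagonal_corner)
  next
    case 4
    have "det (mat N N (\<lambda>(i, j). diff_row k i j :: 'a)) = 0"
      by (rule det_eq_0_if_row_dependent[where p = k and S = "{Suc k}" and w = "\<lambda>_. -1"])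
        (use 4 assms in \<open>auto simp: diff_row_def\<close>)
    then show ?thesis using 4 by simp
  qed simp
qed

section \<open>The Hankel determinants\<close>

theorem theorem1p6:
  fixes k n r N :: nat and c :: "int poly"
  assumes "c = [:0, 1:]"
    and "N = (2 * k + 1) * n + r"
    and "r \<le> 2 * k"
  shows "det (mat N N (\<lambda>(i, j). Cat_bc 1 c (i + j) (int k))) =
    (if r = 0 then 1
     else if r = k + 1 then (-1) ^ ((k + 1) choose 2)
     else 0)"
proof -
  have "det (mat N N (\<lambda>(i, j). Cat_bc 1 c (i + j) (int k))) =
      (-1) ^ (k * N) * det (mat N N (\<lambda>(i, j). diff_row k i j))"
    by (simp only: det_Cat_bc_eq det_triangle_eq_det_diff_row)
  also have "\<dots> = (if r = 0 then 1 else if r = k + 1 then (-1) ^ (Suc k choose 2) else 0)"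
  proof (cases "n = 0")
    case True
    then have "N = r" using assms by simp
    then have "det (mat N N (\<lambda>(i, j). diff_row k i j)) =
        (if r = 0 then 1 else if r = k + 1 then (-1) ^ (Suc k choose 2) else (0 :: int poly))"
      using det_diff_row_small[of N k, where 'a = "int poly"] assms(3) by simp
    moreover have "(-1 :: int poly) ^ (k * (k + 1)) = 1"
      by (rule neg_one_even_power) simp
    ultimately show ?thesis
      using \<open>N = r\<close> by (cases "r = 0"; cases "r = k + 1"; simp only: if_True if_False) simp_all
  next
    case False
    define m where "m = N - (2 * k + 1)"
    have "N = (2 * k + 1) + m"
      using assms(2) False unfolding m_def by (cases n) auto
    \<comment> \<open>The signs collected from \<open>p\<^sub>k\<close>, from the deleted identity block and from the \<open>k\<close> negated units
        cancel, because \<open>N\<close> and \<open>m\<close> differ by the odd period.\<close>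
    then have "even (k * N + k * m + k)"
      by (cases "even k"; cases "even m") simp_all
    then have "(-1) ^ (k * N) * ((-1) ^ (k * m) * (-1) ^ k) = (1 :: int poly)"
      by (metis power_add mult.assoc neg_one_even_power)
    then show ?thesis
      using det_diff_row_reduce[of N k n r, where 'a = "int poly"] det_arc_mat[of r k, where 'a = "int poly"]
        assms False by (simp add: m_def mult.assoc[symmetric])
  qed
  finally show ?thesis by simp
qed

end
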